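(* Let $\Gamma$ be a countably infinite discrete group and let $\boldsymbol{a} = \Gamma \curvearrowright^a (X,\mu)$ be a non-trivial measure preserving action of $\Gamma$. Suppose that $\boldsymbol{a}$ is totally ergodic. Then there exists a finite normal subgroup $N$ of $\Gamma$ such that the stabilizer $\Gamma_x$ of $\mu$-almost every $x\in X$ is equal to $N$.
   Context: A measure preserving action $\boldsymbol{a}=\Gamma\curvearrowright^a (X,\mu)$ consists of a standard Borel space $X$, a Borel probability measure $\mu$ on $X$, and a Borel action $a:\Gamma\times X\to X$ preserving $\mu$; write $\gamma^a x$ for $a(\gamma,x)$. The action is non-trivial if $\mu$ is not a point mass. It is totally ergodic if the restriction of the action to every infinite subgroup of $\Gamma$ is ergodic. The stabilizer of $x$ is $\Gamma_x=\{\gamma\in\Gamma : \gamma^a x = x\}$. *)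

theory Defs
  imports "HOL-Probability.Probability" "HOL-Algebra.Algebra"
begin

definition standard_borel :: "'x measure \<Rightarrow> bool" where
  "standard_borel M \<longleftrightarrow> (\<exists>T :: 'x topology.
      completely_metrizable_space T \<and> separable_space T \<and> topspace T = space M \<and>
      sets M = sigma_sets (topspace T) {U. openin T U})"

definition mp_action :: "('g, 'b) monoid_scheme \<Rightarrow> 'x measure \<Rightarrow> ('g \<Rightarrow> 'x \<Rightarrow> 'x) \<Rightarrow> bool" where
  "mp_action G M a \<longleftrightarrow> group G \<and> standard_borel M \<and> prob_space M \<and>
     (\<forall>x\<in>space M. a \<one>\<^bsub>G\<^esub> x = x) \<and>
     (\<forall>g\<in>carrier G. \<forall>h\<in>carrier G. \<forall>x\<in>space M. a (g \<otimes>\<^bsub>G\<^esub> h) x = a g (a h x)) \<and>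
     (\<forall>g\<in>carrier G. a g \<in> measurable M M \<and> distr M M (a g) = M)"

definition point_mass :: "'x measure \<Rightarrow> bool" where
  "point_mass M \<longleftrightarrow> (\<exists>x\<in>space M. \<forall>A\<in>sets M. emeasure M A = indicator A x)"

definition ergodic_on :: "'g set \<Rightarrow> 'x measure \<Rightarrow> ('g \<Rightarrow> 'x \<Rightarrow> 'x) \<Rightarrow> bool" where
  "ergodic_on H M a \<longleftrightarrow> (\<forall>A\<in>sets M. (\<forall>h\<in>H. a h -` A \<inter> space M = A) \<longrightarrow>
      measure M A = 0 \<or> measure M A = 1)"

definition totally_ergodic :: "('g, 'b) monoid_scheme \<Rightarrow> 'x measure \<Rightarrow> ('g \<Rightarrow> 'x \<Rightarrow> 'x) \<Rightarrow> bool" where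
  "totally_ergodic G M a \<longleftrightarrow> (\<forall>H. subgroup H G \<and> infinite H \<longrightarrow> ergodic_on H M a)"

definition point_stabilizer :: "('g, 'b) monoid_scheme \<Rightarrow> ('g \<Rightarrow> 'x \<Rightarrow> 'x) \<Rightarrow> 'x \<Rightarrow> 'g set" where
  "point_stabilizer G a x = {g \<in> carrier G. a g x = x}"

end

theory Submission
  imports Defs
begin

text \<open>
  If \<open>H\<close> is an infinite subgroup, then the fixed-point set of \<open>H\<close> is null, and the fixed-point set of
  an element commuting with \<open>H\<close> is null or conull. Moreover \<open>\<mu>\<close> has no atoms, so there are infinitely
  many disjoint sets of positive measure; almost every \<open>H\<close>-orbit meets all of them and is infinite.

  Suppose that stabilizers are infinite with positive probability. A finitely generated subgroup of a
  typical stabilizer has a non-null fixed-point set, hence is finite. So a typical stabilizer is an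
  increasing union \<open>H\<close> of finite groups \<open>F n\<close>, and it contains some \<open>g\<close> whose fixed-point set has
  measure \<open>c\<close> with \<open>0 < c < 1\<close>. The centralizer of \<open>g\<close> in \<open>H\<close> is finite, say of order \<open>m\<close>. All
  conjugates of \<open>g\<close> have fixed-point sets of measure \<open>c\<close>, and \<open>h \<mapsto> h g h\<inverse>\<close> has fibres of size at
  most \<open>m\<close>, so the expected density of the stabilizer of \<open>y\<close> in \<open>F n\<close> is at least \<open>c / m\<close> for all
  large \<open>n\<close>. But this density is the reciprocal of the size of the \<open>F n\<close>-orbit of \<open>y\<close>, which tends
  to infinity almost everywhere. This counting argument takes the place of the theorem of
  Hall--Kulatilaka and Kargapolov (infinite locally finite groups have infinite abelian subgroups),
  which rests on the Feit--Thompson theorem.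

  Hence almost every stabilizer is finite, and some finite \<open>F\<close> is the stabilizer on a set of positive
  measure. The translates of this set are equal or disjoint, so an infinite subgroup preserves it;
  by ergodicity it is conull, which makes \<open>F\<close> normal.
\<close>

section \<open>Separation of points and atoms in standard Borel spaces\<close>

text \<open>For a compatible metric, the balls of radius \<open>1 / (n + 1)\<close> around the
  points of a countable dense set do this. It is what the later proofs use of the Polish
  topology.\<close>

lemma standard_borel_separating_family:
  assumes "standard_borel M"
  obtains \<U> where "countable \<U>" "\<U> \<subseteq> sets M"
    "\<And>x y. x \<in> space M \<Longrightarrow> y \<in> space M \<Longrightarrow> x \<noteq> y \<Longrightarrow> \<exists>U\<in>\<U>. x \<in> U \<and> y \<notin> U"
proof -
  obtain T :: "'a topology" where T: "completely_metrizable_space T" "separable_space T"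
    "topspace T = space M" "sets M = sigma_sets (topspace T) {U. openin T U}"
    using assms unfolding standard_borel_def by blast
  obtain S d where metric: "Metric_space S d" and TS: "T = Metric_space.mtopology S d"
    using completely_metrizable_imp_metrizable_space[OF T(1)] unfolding metrizable_space_def by blast
  interpret Metric_space S d by (rule metric)
  obtain C where C: "countable C" "C \<subseteq> S" "mtopology closure_of C = S"
    using T(2) unfolding separable_space_def TS by auto
  have Ssp: "S = space M" using T(3) TS by simp
  define \<U> where "\<U> = (\<lambda>(c, n :: nat). mball c (inverse (real (Suc n)))) ` (C \<times> UNIV)"
  show ?thesis
  proof
    show "countable \<U>" unfolding \<U>_def using C(1) by auto
    show "\<U> \<subseteq> sets M" unfolding \<U>_def T(4) TS by (auto intro: sigma_sets.Basic)
    fix x y assume xy: "x \<in> space M" "y \<in> space M" "x \<noteq> y"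
    hence "0 < d x y / 2" using Ssp by simp
    \<comment> \<open>A ball of radius less than half of \<open>d x y\<close> cannot contain both
      \<open>x\<close> and \<open>y\<close>.\<close>
    then obtain n where n: "inverse (real (Suc n)) < d x y / 2"
      using reals_Archimedean by blast
    have "x \<in> mtopology closure_of C" using C(3) xy Ssp by simp
    then obtain c where c: "c \<in> C" "c \<in> mball x (inverse (real (Suc n)))"
      unfolding metric_closure_of
      by (auto simp del: of_nat_Suc dest: spec[of _ "inverse (real (Suc n))"])
    have "d x y \<le> d x c + d c y" using triangle c C(2) xy Ssp by blast
    hence "y \<notin> mball c (inverse (real (Suc n)))" using n c by auto
    moreover have "x \<in> mball c (inverse (real (Suc n)))" using c by (simp add: commute)
    ultimately show "\<exists>U\<in>\<U>. x \<in> U \<and> y \<notin> U" unfolding \<U>_def using c(1) by blast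
  qed
qed

text \<open>Each separating set \<open>U\<close> cuts \<open>A\<close> into two parts, and
  \<open>B U\<close> is the one carrying all the mass. Intersecting these countably many parts loses
  no mass, yet any two distinct points are told apart by some \<open>U\<close>, so only one point
  survives.\<close>

lemma (in finite_measure) standard_borel_atom_point:
  assumes standard: "standard_borel M" and A: "A \<in> sets M" "measure M A > 0"
    and atom: "\<And>B. B \<in> sets M \<Longrightarrow> measure M (A \<inter> B) = 0 \<or> measure M (A - B) = 0"
  obtains x where "x \<in> A" "{x} \<in> sets M" "measure M {x} = measure M A"
proof -
  obtain \<U> where U: "countable \<U>" "\<U> \<subseteq> sets M"
    "\<And>x y. x \<in> space M \<Longrightarrow> y \<in> space M \<Longrightarrow> x \<noteq> y \<Longrightarrow> \<exists>U\<in>\<U>. x \<in> U \<and> y \<notin> U"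
    using standard_borel_separating_family[OF standard] by metis
  define B where "B = (\<lambda>U. if measure M (A \<inter> U) = 0 then A - U else A \<inter> U)"
  define C where "C = {x \<in> space M. \<forall>U\<in>\<U>. x \<in> B U} \<inter> A"
  have B: "B U \<in> sets M" "AE x in M. x \<in> A \<longrightarrow> x \<in> B U" if "U \<in> \<U>" for U
  proof -
    have sU: "U \<in> sets M" using U(2) that by blast
    thus "B U \<in> sets M" using A(1) by (auto simp: B_def)
    have "A - B U \<in> null_sets M"
    proof (cases "measure M (A \<inter> U) = 0")
      case True
      moreover have "A - (A - U) = A \<inter> U" by blast
      ultimately show ?thesis using sU A(1)
        by (auto simp: B_def null_sets_def emeasure_eq_measure)
    next
      case False
      moreover have "A - A \<inter> U = A - U" by blast
      ultimately show ?thesis using sU A(1) atom[OF sU]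
        by (auto simp: B_def null_sets_def emeasure_eq_measure)
    qed
    from AE_not_in[OF this] show "AE x in M. x \<in> A \<longrightarrow> x \<in> B U" by auto
  qed
  have C: "C \<in> sets M" unfolding C_def
    using B(1) U(1) A(1) by (auto intro!: sets.sets_Collect_countable_All' intro: sets.Int simp: sets.Int_space_eq1)
  have "AE x in M. \<forall>U\<in>\<U>. x \<in> A \<longrightarrow> x \<in> B U"
    using B(2) by (intro AE_ball_countable' U(1))
  hence "AE x in M. x \<in> C \<longleftrightarrow> x \<in> A"
    using AE_space by eventually_elim (auto simp: C_def)
  hence eq: "measure M C = measure M A" using C A(1) by (intro measure_eq_AE)
  hence "C \<noteq> {}" using A(2) by auto
  then obtain x where x: "x \<in> C" by blast
  have "y = x" if "y \<in> C" for y
  proof (rule ccontr)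
    assume "y \<noteq> x"
    moreover have "x \<in> space M" "y \<in> space M" using x that unfolding C_def by auto
    ultimately obtain V where V: "V \<in> \<U>" "x \<in> V" "y \<notin> V" using U(3) by metis
    hence "x \<in> B V" "y \<in> B V" using x that unfolding C_def by auto
    thus False using V unfolding B_def by (auto split: if_splits)
  qed
  hence "C = {x}" using x by blast
  thus ?thesis using that[of x] C eq x unfolding C_def by auto
qed

section \<open>Finiteness and counting principles\<close>

lemma (in finite_measure) finite_disjoint_equal_measure:
  assumes "disjoint_family_on A I" "\<And>i. i \<in> I \<Longrightarrow> A i \<in> sets M"
    "\<And>i. i \<in> I \<Longrightarrow> measure M (A i) = p" "p > 0"
  shows "finite I"
proof (rule ccontr)
  assume "infinite I"
  obtain n :: nat where n: "measure M (space M) < real n * p"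
    using \<open>p > 0\<close> reals_Archimedean3 by blast
  obtain J where J: "finite J" "J \<subseteq> I" "card J = n"
    using infinite_arbitrarily_large[OF \<open>infinite I\<close>] by blast
  have "real n * p = (\<Sum>i\<in>J. measure M (A i))"
    using J assms(3) by (simp add: subset_iff)
  also have "\<dots> = measure M (\<Union>i\<in>J. A i)"
    using J assms(2) disjoint_family_on_mono[OF J(2) assms(1)]
    by (intro finite_measure_finite_Union[symmetric]) auto
  also have "\<dots> \<le> measure M (space M)"
    by (rule bounded_measure)
  finally show False using n by simp
qed

lemma finite_subset_incseq:
  fixes F :: "nat \<Rightarrow> 'c set"
  assumes "finite T" "T \<subseteq> (\<Union>n. F n)" "incseq F"
  obtains N where "\<And>n. n \<ge> N \<Longrightarrow> T \<subseteq> F n"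
proof -
  have "\<forall>t\<in>T. \<exists>n. t \<in> F n" using assms(2) by blast
  then obtain k where k: "\<And>t. t \<in> T \<Longrightarrow> t \<in> F (k t)" by metis
  have "T \<subseteq> F n" if "n \<ge> Max (k ` T)" for n
  proof
    fix t assume t: "t \<in> T"
    have "k t \<le> Max (k ` T)" using t assms(1) by simp
    hence "k t \<le> n" using that by simp
    thus "t \<in> F n" using k[OF t] monoD[OF assms(3)] by blast
  qed
  thus ?thesis by (rule that)
qed

lemma card_le_mult_card_fibres:
  assumes "finite A" "\<And>b. b \<in> B \<Longrightarrow> card {x \<in> A. f x = b} \<le> m" "finite B" "f ` A \<subseteq> B"
  shows "card A \<le> m * card B"
proof -
  have "card A = (\<Sum>b\<in>B. card {x \<in> A. f x = b})"
    using sum_fun_comp[OF assms(1,3,4), of "\<lambda>_. 1::nat"] by simp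
  also have "\<dots> \<le> (\<Sum>b\<in>B. m)" using assms(2) by (rule sum_mono)
  finally show ?thesis by (simp add: mult.commute)
qed

text \<open>Some fibre of \<open>f\<close> is infinite, and right translation by the inverse of one
  of its elements injects it into \<open>S\<close>. In the applications \<open>f h\<close> is a
  translate of a point or of a set, and \<open>S\<close> is the stabilizer of that point or
  set.\<close>

lemma (in group) infinite_subgroup_of_finite_image:
  assumes H: "subgroup H G" "infinite H" and "finite (f ` H)"
    and S: "\<And>h k. h \<in> H \<Longrightarrow> k \<in> H \<Longrightarrow> f h = f k \<Longrightarrow> k \<otimes> inv h \<in> S"
  shows "infinite S"
proof
  assume fin: "finite S"
  interpret H: subgroup H G by (rule H)
  obtain h where h: "h \<in> H" "infinite {k \<in> H. f k = f h}"
    using pigeonhole_infinite[OF \<open>infinite H\<close> assms(3)] by blast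
  have "inj_on (\<lambda>k. k \<otimes> inv h) {k \<in> H. f k = f h}"
    using h by (auto intro!: inj_onI)
  moreover have "(\<lambda>k. k \<otimes> inv h) ` {k \<in> H. f k = f h} \<subseteq> S" using S h(1) by auto
  ultimately show False using fin h(2) finite_imageD finite_subset by metis
qed

section \<open>Measure preserving actions: fixed-point sets and stabilizers\<close>

locale pmp_action = group G + prob_space M
  for G :: "('g, 'b) monoid_scheme" (structure) and M :: "'x measure" +
  fixes a :: "'g \<Rightarrow> 'x \<Rightarrow> 'x"
  assumes countable_carrier: "countable (carrier G)"
    and standard: "standard_borel M"
    and act_one [simp]: "x \<in> space M \<Longrightarrow> a \<one> x = x"
    and act_mult: "g \<in> carrier G \<Longrightarrow> h \<in> carrier G \<Longrightarrow> x \<in> space M \<Longrightarrow> a (g \<otimes> h) x = a g (a h x)"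
    and act_measurable [measurable (raw)]: "g \<in> carrier G \<Longrightarrow> a g \<in> measurable M M"
    and act_distr: "g \<in> carrier G \<Longrightarrow> distr M M (a g) = M"
begin

definition fixed :: "'g set \<Rightarrow> 'x set" where
  "fixed S = {x \<in> space M. \<forall>g\<in>S. a g x = x}"

abbreviation stab :: "'x \<Rightarrow> 'g set" where
  "stab x \<equiv> point_stabilizer G a x"

lemma act_space [simp]: "g \<in> carrier G \<Longrightarrow> x \<in> space M \<Longrightarrow> a g x \<in> space M"
  using act_measurable measurable_space by metis

lemma act_inv_act [simp]: "g \<in> carrier G \<Longrightarrow> x \<in> space M \<Longrightarrow> a (inv g) (a g x) = x"
  using act_mult[of "inv g" g x] by simp

lemma act_act_inv [simp]: "g \<in> carrier G \<Longrightarrow> x \<in> space M \<Longrightarrow> a g (a (inv g) x) = x"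
  using act_mult[of g "inv g" x] by simp

lemma sets_vimage:
  "g \<in> carrier G \<Longrightarrow> A \<in> sets M \<Longrightarrow> a g -` A \<inter> space M \<in> sets M"
  by (rule measurable_sets[OF act_measurable])

lemma prob_vimage:
  assumes "g \<in> carrier G" "A \<in> sets M"
  shows "prob (a g -` A \<inter> space M) = prob A"
  using measure_distr[OF act_measurable[OF assms(1)] assms(2)] act_distr[OF assms(1)] by simp

lemma countable_subset_carrier: "S \<subseteq> carrier G \<Longrightarrow> countable S"
  using countable_carrier countable_subset by blast

text \<open>The equation \<open>a g x = x\<close> holds iff both sides lie in the same members of a
  countable separating family, which is a countable conjunction of measurable conditions.
  Countability of the group handles the quantifier over \<open>S\<close>.\<close>

lemma sets_fixed [simp]:
  assumes "S \<subseteq> carrier G"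
  shows "fixed S \<in> sets M"
proof -
  obtain \<U> where U: "countable \<U>" "\<U> \<subseteq> sets M"
    "\<And>x y. x \<in> space M \<Longrightarrow> y \<in> space M \<Longrightarrow> x \<noteq> y \<Longrightarrow> \<exists>U\<in>\<U>. x \<in> U \<and> y \<notin> U"
    using standard_borel_separating_family[OF standard] by metis
  have eq: "{x \<in> space M. a g x = x} = {x \<in> space M. \<forall>U\<in>\<U>. a g x \<in> U \<longleftrightarrow> x \<in> U}"
    if "g \<in> carrier G" for g
    using U(3) that by (auto dest: act_space)
  have g: "{x \<in> space M. a g x = x} \<in> sets M" if "g \<in> S" for g
    unfolding eq[OF subsetD[OF assms that]]
  proof (rule sets.sets_Collect_countable_All'[OF _ U(1)])
    fix U assume "U \<in> \<U>"
    hence "U \<in> sets M" using U(2) by blast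
    moreover have "a g \<in> measurable M M" using assms that by (auto intro: act_measurable)
    ultimately show "{x \<in> space M. (a g x \<in> U) = (x \<in> U)} \<in> sets M" by measurable
  qed
  show ?thesis
    unfolding fixed_def
    by (rule sets.sets_Collect_countable_All'[OF g countable_subset_carrier[OF assms]]) auto
qed

lemma subgroup_stab:
  assumes "x \<in> space M"
  shows "subgroup (stab x) G"
proof (rule subgroupI)
  show "stab x \<subseteq> carrier G" by (auto simp: point_stabilizer_def)
  show "stab x \<noteq> {}" using assms by (auto simp: point_stabilizer_def)
  show "inv g \<in> stab x" if "g \<in> stab x" for g
    using that assms by (simp add: point_stabilizer_def) (metis act_inv_act)
  show "g \<otimes> h \<in> stab x" if "g \<in> stab x" "h \<in> stab x" for g h
    using that assms act_mult[of g h x] by (auto simp: point_stabilizer_def)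
qed

lemma stab_act:
  assumes "h \<in> carrier G" "g \<in> carrier G" "x \<in> space M"
  shows "g \<in> stab (a h x) \<longleftrightarrow> inv h \<otimes> g \<otimes> h \<in> stab x"
proof -
  have "a (inv h \<otimes> g \<otimes> h) x = a (inv h) (a g (a h x))"
    using assms by (simp add: act_mult)
  thus ?thesis using assms by (simp add: point_stabilizer_def) (metis act_act_inv act_inv_act act_space)
qed

lemma fixed_generate:
  assumes "S \<subseteq> carrier G"
  shows "fixed (generate G S) = fixed S"
proof
  show "fixed (generate G S) \<subseteq> fixed S" by (auto simp: fixed_def generate.incl)
  show "fixed S \<subseteq> fixed (generate G S)"
  proof
    fix x assume x: "x \<in> fixed S"
    hence "S \<subseteq> stab x" "x \<in> space M" using assms by (auto simp: fixed_def point_stabilizer_def)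
    hence "generate G S \<subseteq> stab x" using generate_subgroup_incl subgroup_stab by blast
    thus "x \<in> fixed (generate G S)" using x by (auto simp: fixed_def point_stabilizer_def)
  qed
qed

text \<open>The fixed-point set of the conjugate is the preimage of \<open>fixed {g}\<close> under
  \<open>a (inv h)\<close>, and preimages preserve measure.\<close>

lemma prob_fixed_conjugate:
  assumes "g \<in> carrier G" "h \<in> carrier G"
  shows "prob (fixed {h \<otimes> g \<otimes> inv h}) = prob (fixed {g})"
proof -
  have "a (inv h) -` fixed {g} \<inter> space M = fixed {h \<otimes> g \<otimes> inv h}"
    using assms by (auto simp: fixed_def act_mult) (metis act_inv_act act_space inv_closed act_act_inv)+
  thus ?thesis using prob_vimage[of "inv h" "fixed {g}"] assms by simp
qed

text \<open>This is the half of the orbit-stabilizer formula that bounds stabilizer density by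
  inverse orbit size. With \<open>r y\<close> in \<open>F\<close> carrying \<open>x\<close> to
  \<open>y\<close>, the products \<open>r y \<otimes> s\<close> are distinct elements of
  \<open>F\<close>.\<close>

lemma card_orbit_stab_le:
  assumes F: "subgroup F G" "finite F" and x: "x \<in> space M"
  shows "card ((\<lambda>h. a h x) ` F) * card (F \<inter> stab x) \<le> card F"
proof -
  interpret F: subgroup F G by (rule F)
  have "\<forall>y\<in>(\<lambda>h. a h x) ` F. \<exists>h. h \<in> F \<and> a h x = y" by blast
  from bchoice[OF this] obtain r
    where r: "\<And>y. y \<in> (\<lambda>h. a h x) ` F \<Longrightarrow> r y \<in> F \<and> a (r y) x = y" by blast
  have act: "a (r y \<otimes> s) x = y" if "y \<in> (\<lambda>h. a h x) ` F" "s \<in> F \<inter> stab x" for y s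
    using r[OF that(1)] that(2) x by (auto simp: act_mult point_stabilizer_def)
  have "inj_on (\<lambda>(y, s). r y \<otimes> s) ((\<lambda>h. a h x) ` F \<times> (F \<inter> stab x))"
  proof (rule inj_onI, clarify)
    fix h k s t
    assume *: "h \<in> F" "k \<in> F" "s \<in> F" "s \<in> stab x" "t \<in> F" "t \<in> stab x"
      "r (a h x) \<otimes> s = r (a k x) \<otimes> t"
    hence eq: "a h x = a k x" using act[of "a h x" s] act[of "a k x" t] by auto
    moreover have "s = t"
      using * r[of "a h x"] unfolding eq by (auto simp: F.mem_carrier)
    ultimately show "a h x = a k x \<and> s = t" by simp
  qed
  moreover have "(\<lambda>(y, s). r y \<otimes> s) ` ((\<lambda>h. a h x) ` F \<times> (F \<inter> stab x)) \<subseteq> F"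
    using r by auto
  ultimately show ?thesis
    using card_inj_on_le F(2) by (metis card_cartesian_product)
qed

end

section \<open>Consequences of ergodicity of infinite subgroups\<close>

locale totally_ergodic_action = pmp_action G M a
  for G :: "('g, 'b) monoid_scheme" (structure) and M :: "'x measure" and a +
  assumes infinite_carrier: "infinite (carrier G)"
    and not_point_mass: "\<not> point_mass M"
    and totally_ergodic: "totally_ergodic G M a"
begin

text \<open>Otherwise the whole space is an atom, so a single point carries all the mass and the
  measure is a point mass.\<close>

lemma exists_intermediate_prob:
  obtains A where "A \<in> sets M" "0 < prob A" "prob A < 1"
proof (rule ccontr)
  assume no: "\<not> thesis"
  note witness = that
  have *: "prob A = 0 \<or> prob A = 1" if "A \<in> sets M" for A
    using no witness[OF that] measure_nonneg[of M A] prob_le_1[of A] by (metis less_eq_real_def)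
  have "prob (space M \<inter> A) = 0 \<or> prob (space M - A) = 0" if "A \<in> sets M" for A
    using *[OF that] that by (auto simp: prob_compl)
  then obtain x where x: "x \<in> space M" "{x} \<in> sets M" "prob {x} = 1"
    using standard_borel_atom_point[OF standard sets.top] prob_space by auto
  have "emeasure M A = indicator A x" if A: "A \<in> sets M" for A
  proof (cases "x \<in> A")
    case True
    hence "prob A \<ge> 1" using finite_measure_mono[of "{x}" A] x A by simp
    thus ?thesis using True prob_le_1[of A] by (simp add: emeasure_eq_measure)
  next
    case False
    hence "prob (A \<union> {x}) = prob A + 1" using finite_measure_Union[OF A x(2)] x(3) by simp
    hence "prob A = 0" using prob_le_1[of "A \<union> {x}"] measure_nonneg[of M A] by linarith
    thus ?thesis using False by (simp add: emeasure_eq_measure)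
  qed
  thus False using not_point_mass x(1) unfolding point_mass_def by blast
qed

lemma ergodic_invariant:
  assumes "subgroup H G" "infinite H" "A \<in> sets M"
    and "\<And>h. h \<in> H \<Longrightarrow> a h -` A \<inter> space M = A"
  shows "prob A = 0 \<or> prob A = 1"
proof -
  have "ergodic_on H M a" using totally_ergodic assms(1,2) by (simp add: totally_ergodic_def)
  thus ?thesis using assms(3,4) by (simp add: ergodic_on_def)
qed

text \<open>\<open>ergodic_on\<close> concerns strictly invariant sets only. The set
  \<open>B\<close> of points whose whole \<open>H\<close>-orbit lies in \<open>A\<close> is strictly
  invariant, and it differs from \<open>A\<close> by a null set because \<open>H\<close> is
  countable.\<close>

lemma ergodic_AE_invariant:
  assumes H: "subgroup H G" "infinite H" and A: "A \<in> sets M"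
    and inv: "\<And>h. h \<in> H \<Longrightarrow> AE x in M. a h x \<in> A \<longleftrightarrow> x \<in> A"
  shows "prob A = 0 \<or> prob A = 1"
proof -
  interpret H: subgroup H G by (rule H)
  have cH: "countable H" using countable_subset_carrier H.subset by blast
  define B where "B = {x \<in> space M. \<forall>h\<in>H. a h x \<in> A}"
  have B: "B \<in> sets M" unfolding B_def
  proof (rule sets.sets_Collect_countable_All'[OF _ cH])
    fix h assume "h \<in> H"
    hence "a h -` A \<inter> space M \<in> sets M" using A by (intro sets_vimage) auto
    thus "{x \<in> space M. a h x \<in> A} \<in> sets M" by (simp add: vimage_def Int_def conj_commute)
  qed
  have "AE x in M. \<forall>h\<in>H. a h x \<in> A \<longleftrightarrow> x \<in> A"
    using inv by (intro AE_ball_countable' cH)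
  hence "AE x in M. x \<in> A \<longleftrightarrow> x \<in> B"
    using AE_space
  proof eventually_elim
    case (elim x)
    have "(\<forall>h\<in>H. a h x \<in> A) \<Longrightarrow> a \<one> x \<in> A" by (drule bspec[OF _ H.one_closed])
    thus ?case using elim by (auto simp: B_def)
  qed
  hence "prob A = prob B" using A B by (intro measure_eq_AE)
  moreover have "a k -` B \<inter> space M = B" if k: "k \<in> H" for k
  proof -
    have "(\<forall>h\<in>H. a h (a k x) \<in> A) \<longleftrightarrow> (\<forall>h\<in>H. a h x \<in> A)" if x: "x \<in> space M" for x
    proof safe
      fix h assume *: "\<forall>h\<in>H. a h (a k x) \<in> A" "h \<in> H"
      have "a (h \<otimes> inv k) (a k x) \<in> A" using * k by auto
      thus "a h x \<in> A" using * k x by (simp add: act_mult H.mem_carrier)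
    next
      fix h assume *: "\<forall>h\<in>H. a h x \<in> A" "h \<in> H"
      have "a (h \<otimes> k) x \<in> A" using * k by auto
      thus "a h (a k x) \<in> A" using * k x by (simp add: act_mult H.mem_carrier)
    qed
    thus ?thesis using k by (auto simp: B_def H.mem_carrier)
  qed
  ultimately show ?thesis using ergodic_invariant[OF H B] by auto
qed

text \<open>\<open>fixed H\<close> is \<open>H\<close>-invariant, so if it is not null it is conull.
  Then \<open>H\<close> acts trivially almost everywhere and every measurable set is almost
  invariant, including one of measure strictly between 0 and 1.\<close>

lemma prob_fixed_infinite_subgroup:
  assumes H: "subgroup H G" "infinite H"
  shows "prob (fixed H) = 0"
proof (rule ccontr)
  interpret H: subgroup H G by (rule H)
  assume "prob (fixed H) \<noteq> 0"
  have "a h -` fixed H \<inter> space M = fixed H" if h: "h \<in> H" for h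
  proof (intro equalityI subsetI)
    fix x assume "x \<in> a h -` fixed H \<inter> space M"
    hence x: "a h x \<in> fixed H" "x \<in> space M" by auto
    have "a (inv h) (a h x) = a h x" using x h by (auto simp: fixed_def)
    hence "a h x = x" using x h by (simp add: H.mem_carrier)
    thus "x \<in> fixed H" using x by simp
  next
    fix x assume "x \<in> fixed H"
    thus "x \<in> a h -` fixed H \<inter> space M" using h by (auto simp: fixed_def)
  qed
  hence "prob (fixed H) = 1"
    using ergodic_invariant[OF H sets_fixed[OF H.subset]] \<open>prob (fixed H) \<noteq> 0\<close> by blast
  hence AE: "AE x in M. x \<in> fixed H" by (rule AE_prob_1)
  obtain A where A: "A \<in> sets M" "0 < prob A" "prob A < 1" by (rule exists_intermediate_prob)
  have "AE x in M. a h x \<in> A \<longleftrightarrow> x \<in> A" if "h \<in> H" for h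
    using AE that by (auto simp: fixed_def elim: eventually_mono)
  thus False using ergodic_AE_invariant[OF H A(1)] A by auto
qed

text \<open>Elements commuting with \<open>g\<close> permute its fixed points, so
  \<open>fixed {g}\<close> is \<open>H\<close>-invariant.\<close>

lemma prob_fixed_centralised:
  assumes H: "subgroup H G" "infinite H" and g: "g \<in> carrier G"
    and comm: "\<And>h. h \<in> H \<Longrightarrow> h \<otimes> g = g \<otimes> h"
  shows "prob (fixed {g}) = 0 \<or> prob (fixed {g}) = 1"
proof (rule ergodic_invariant[OF H])
  interpret H: subgroup H G by (rule H)
  show "fixed {g} \<in> sets M" using g by simp
  fix h assume h: "h \<in> H"
  have "a g (a h x) = a h (a g x)" if "x \<in> space M" for x
    using comm[OF h] g h that by (metis act_mult H.mem_carrier)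
  moreover have "a h x = a h y \<longleftrightarrow> x = y" if "x \<in> space M" "y \<in> space M" for x y
    using that h by (metis act_inv_act H.mem_carrier)
  ultimately show "a h -` fixed {g} \<inter> space M = fixed {g}"
    using g h by (auto simp: fixed_def H.mem_carrier)
qed

section \<open>Absence of atoms and infinite orbits\<close>

text \<open>All points in the orbit of an atom have the same mass, so the orbit is finite and the
  stabilizer infinite. The fixed-point set of that stabilizer is then null, although it contains the
  atom.\<close>

lemma prob_singleton:
  assumes x: "x \<in> space M" "{x} \<in> sets M"
  shows "prob {x} = 0"
proof (rule ccontr)
  assume nz: "prob {x} \<noteq> 0"
  have eq: "a h -` {x} \<inter> space M = {a (inv h) x}" if "h \<in> carrier G" for h
    using that x by auto
  have sets: "{y} \<in> sets M" "prob {y} = prob {x}"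
    if "y \<in> (\<lambda>h. a (inv h) x) ` carrier G" for y
  proof -
    obtain h where h: "h \<in> carrier G" "y = a (inv h) x" using \<open>y \<in> _\<close> by blast
    show "{y} \<in> sets M" "prob {y} = prob {x}"
      using sets_vimage[OF h(1) x(2)] prob_vimage[OF h(1) x(2)] eq[OF h(1)] h(2) by simp_all
  qed
  \<comment> \<open>The inverse appears because the preimage of \<open>{x}\<close> under
    \<open>a h\<close> is \<open>{a (inv h) x}\<close>; it also makes
    \<open>k \<otimes> inv h\<close> the element that fixes \<open>x\<close> when \<open>h\<close>
    and \<open>k\<close> give the same point.\<close>
  have "finite ((\<lambda>h. a (inv h) x) ` carrier G)"
    using sets nz
    by (intro finite_disjoint_equal_measure[of "\<lambda>y. {y}" _ "prob {x}"])
       (auto simp: disjoint_family_on_def zero_less_measure_iff)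
  moreover have "k \<otimes> inv h \<in> stab x"
    if hk: "h \<in> carrier G" "k \<in> carrier G" "a (inv h) x = a (inv k) x" for h k
    using hk x by (simp add: point_stabilizer_def act_mult)
  ultimately have "infinite (stab x)"
    using infinite_subgroup_of_finite_image[OF subgroup_self infinite_carrier] by blast
  hence "prob (fixed (stab x)) = 0" using subgroup_stab x prob_fixed_infinite_subgroup by blast
  moreover have "{x} \<subseteq> fixed (stab x)" using x by (auto simp: fixed_def point_stabilizer_def)
  hence "prob {x} \<le> prob (fixed (stab x))"
    by (intro finite_measure_mono sets_fixed) (auto simp: point_stabilizer_def)
  ultimately show False using nz measure_nonneg[of M "{x}"] by linarith
qed

lemma prob_split:
  assumes A: "A \<in> sets M" "prob A > 0"
  obtains B where "B \<in> sets M" "B \<subseteq> A" "prob B > 0" "prob (A - B) > 0"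
proof (rule ccontr)
  assume no: "\<not> thesis"
  note witness = that
  have "prob (A \<inter> B) = 0 \<or> prob (A - B) = 0" if "B \<in> sets M" for B
  proof (rule ccontr)
    assume *: "\<not> (prob (A \<inter> B) = 0 \<or> prob (A - B) = 0)"
    moreover have "A - A \<inter> B = A - B" by blast
    ultimately show False using no witness[of "A \<inter> B"] A(1) \<open>B \<in> sets M\<close>
      by (auto simp: zero_less_measure_iff)
  qed
  then obtain x where "x \<in> A" "{x} \<in> sets M" "prob {x} = prob A"
    using standard_borel_atom_point[OF standard A] by blast
  thus False using prob_singleton[of x] sets.sets_into_space[OF A(1)] A(2) by auto
qed

text \<open>Repeated splitting keeps one part of positive measure and discards another; the
  discarded parts are the sequence.\<close>

lemma infinite_disjoint_sequence:
  obtains B :: "nat \<Rightarrow> 'x set"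
  where "disjoint_family B" "\<And>n. B n \<in> sets M" "\<And>n. prob (B n) > 0"
proof -
  have "\<exists>A. \<forall>n. (A n \<in> sets M \<and> prob (A n) > 0) \<and>
    (A (Suc n) \<subseteq> A n \<and> prob (A n - A (Suc n)) > 0)"
  proof (rule dependent_nat_choice)
    show "\<exists>A. A \<in> sets M \<and> 0 < prob A" by (rule exI[of _ "space M"]) (simp add: prob_space)
  qed (metis prob_split)
  then obtain A where A: "\<And>n. A n \<in> sets M" "\<And>n. A (Suc n) \<subseteq> A n" "\<And>n. prob (A n - A (Suc n)) > 0"
    by metis
  have "disjoint_family (\<lambda>n. A n - A (Suc n))"
  proof -
    have "(A m - A (Suc m)) \<inter> (A n - A (Suc n)) = {}" if "m < n" for m n
      using lift_Suc_antimono_le[of A "Suc m" n] A(2) that by auto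
    thus ?thesis unfolding disjoint_family_on_def by (metis Int_commute nat_neq_iff)
  qed
  thus ?thesis using that[of "\<lambda>n. A n - A (Suc n)"] A by auto
qed

lemma AE_infinite_orbit:
  assumes H: "subgroup H G" "infinite H"
  shows "AE x in M. infinite ((\<lambda>h. a h x) ` H)"
proof -
  interpret H: subgroup H G by (rule H)
  have cH: "countable H" using countable_subset_carrier H.subset by blast
  obtain B :: "nat \<Rightarrow> 'x set"
    where B: "disjoint_family B" "\<And>n. B n \<in> sets M" "\<And>n. prob (B n) > 0"
    using infinite_disjoint_sequence by metis
  \<comment> \<open>The points whose \<open>H\<close>-orbit meets \<open>B n\<close>: an
    \<open>H\<close>-invariant set containing \<open>B n\<close>, hence conull.\<close>
  define S where "S n = {x \<in> space M. \<exists>h\<in>H. a h x \<in> B n}" for n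
  have "AE x in M. x \<in> S n" for n
  proof -
    have S: "S n \<in> sets M" unfolding S_def
    proof (rule sets.sets_Collect_countable_Ex'[OF _ cH])
      fix h assume "h \<in> H"
      hence "a h -` B n \<inter> space M \<in> sets M" using B(2) by (intro sets_vimage) auto
      thus "{x \<in> space M. a h x \<in> B n} \<in> sets M" by (simp add: vimage_def Int_def conj_commute)
    qed
    have "a k -` S n \<inter> space M = S n" if k: "k \<in> H" for k
    proof (intro equalityI subsetI)
      fix x assume "x \<in> a k -` S n \<inter> space M"
      hence x: "a k x \<in> S n" "x \<in> space M" by auto
      then obtain h where "h \<in> H" "a h (a k x) \<in> B n" unfolding S_def by blast
      hence "h \<otimes> k \<in> H" "a (h \<otimes> k) x \<in> B n" using k x by (auto simp: act_mult H.mem_carrier)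
      thus "x \<in> S n" using x(2) unfolding S_def by blast
    next
      fix x assume x: "x \<in> S n"
      have xs: "x \<in> space M" using x unfolding S_def by blast
      obtain h where "h \<in> H" "a h x \<in> B n" using x unfolding S_def by blast
      hence "h \<otimes> inv k \<in> H" "a (h \<otimes> inv k) (a k x) \<in> B n"
        using k xs by (auto simp: act_mult H.mem_carrier)
      thus "x \<in> a k -` S n \<inter> space M" using xs k by (auto simp: S_def H.mem_carrier)
    qed
    hence "prob (S n) = 0 \<or> prob (S n) = 1" using ergodic_invariant[OF H S] by blast
    moreover have "B n \<subseteq> S n"
    proof
      fix x assume x: "x \<in> B n"
      hence "x \<in> space M" using sets.sets_into_space[OF B(2)] by blast
      thus "x \<in> S n" using x H.one_closed unfolding S_def by (auto intro!: bexI[of _ \<one>])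
    qed
    hence "prob (B n) \<le> prob (S n)" using S by (rule finite_measure_mono)
    ultimately have "prob (S n) = 1" using B(3)[of n] by auto
    thus ?thesis by (rule AE_prob_1)
  qed
  hence "AE x in M. \<forall>n. x \<in> S n" by (simp add: AE_all_countable)
  thus ?thesis
  proof eventually_elim
    case (elim x)
    hence "\<forall>n. \<exists>h. h \<in> H \<and> a h x \<in> B n" unfolding S_def by blast
    then obtain h where h: "\<And>n. h n \<in> H" "\<And>n. a (h n) x \<in> B n" by metis
    have "inj (\<lambda>n. a (h n) x)"
    proof (rule injI, rule ccontr)
      fix m n assume "a (h m) x = a (h n) x" "m \<noteq> n"
      thus False using h(2)[of m] h(2)[of n] disjoint_family_onD[OF B(1), of m n] by auto
    qed
    hence "infinite (range (\<lambda>n. a (h n) x))" by (rule range_inj_infinite)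
    moreover have "range (\<lambda>n. a (h n) x) \<subseteq> (\<lambda>h. a h x) ` H" using h(1) by blast
    ultimately show ?case using finite_subset by blast
  qed
qed

section \<open>Stabilizer densities along increasing unions of finite groups\<close>

text \<open>Any \<open>K\<close> points of an infinite orbit are reached by finitely many group
  elements, hence by \<open>F n\<close> for large \<open>n\<close>. By
  \<open>card_orbit_stab_le\<close> the density is then at most \<open>1 / K\<close>.\<close>

lemma AE_stab_density_tendsto_0:
  assumes F: "\<And>n. subgroup (F n) G" "\<And>n. finite (F n)" "incseq F"
    and H: "subgroup (\<Union>n. F n) G" "infinite (\<Union>n. F n)"
  shows "AE x in M. (\<lambda>n. real (card (F n \<inter> stab x)) / real (card (F n))) \<longlonglongrightarrow> 0"
  using AE_infinite_orbit[OF H] AE_space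
proof eventually_elim
  case (elim x)
  show ?case
  proof (rule LIMSEQ_I)
    fix e :: real assume "e > 0"
    then obtain K :: nat where K: "1 / e < real K" using reals_Archimedean2 by blast
    obtain Y where Y: "Y \<subseteq> (\<lambda>h. a h x) ` (\<Union>n. F n)" "finite Y" "card Y = K"
      using infinite_arbitrarily_large[OF elim(1)] by blast
    obtain T where T: "T \<subseteq> (\<Union>n. F n)" "finite T" "Y = (\<lambda>h. a h x) ` T"
      using finite_subset_image[OF Y(2,1)] by blast
    obtain N where N: "\<And>n. n \<ge> N \<Longrightarrow> T \<subseteq> F n"
      using finite_subset_incseq[OF T(2,1) F(3)] by blast
    have "norm (real (card (F n \<inter> stab x)) / real (card (F n)) - 0) < e" if n: "n \<ge> N" for n
    proof -
      have "Y \<subseteq> (\<lambda>h. a h x) ` F n" using N[OF n] T(3) by blast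
      hence "K \<le> card ((\<lambda>h. a h x) ` F n)" using card_mono[OF finite_imageI[OF F(2)]] Y(3) by auto
      hence "K * card (F n \<inter> stab x) \<le> card (F n)"
        by (rule le_trans[OF mult_le_mono1 card_orbit_stab_le[OF F(1,2) elim(2)]])
      hence le: "real K * real (card (F n \<inter> stab x)) \<le> real (card (F n))"
        by (metis of_nat_mono of_nat_mult)
      have "F n \<noteq> {}" using subgroup.one_closed[OF F(1)] by blast
      hence pos: "real (card (F n)) > 0" using F(2) by (simp add: card_gt_0_iff)
      have "1 < e * real K" using K \<open>e > 0\<close> by (simp add: field_simps)
      have "real (card (F n \<inter> stab x)) < e * real (card (F n))"
      \<comment> \<open>Multiplying \<open>1 < e * real K\<close> by the count keeps the inequality
        strict only if the count is positive.\<close>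
      proof (cases "card (F n \<inter> stab x) = 0")
        case True thus ?thesis using pos \<open>e > 0\<close> by simp
      next
        case False
        hence "1 * real (card (F n \<inter> stab x)) < (e * real K) * real (card (F n \<inter> stab x))"
          using \<open>1 < e * real K\<close> by (intro mult_strict_right_mono) auto
        also have "\<dots> \<le> e * real (card (F n))"
          using mult_left_mono[OF le, of e] \<open>e > 0\<close> by (simp add: mult.assoc)
        finally show ?thesis by simp
      qed
      thus ?thesis using pos by (simp add: field_simps)
    qed
    thus "\<exists>N. \<forall>n\<ge>N. norm (real (card (F n \<inter> stab x)) / real (card (F n)) - 0) < e" by blast
  qed
qed

lemma card_Int_stab_eq_sum:
  assumes "finite F" "F \<subseteq> carrier G" "x \<in> space M"
  shows "real (card (F \<inter> stab x)) = (\<Sum>h\<in>F. indicator (fixed {h}) x)"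
proof -
  have "(\<Sum>h\<in>F. indicator (fixed {h}) x :: real) = (\<Sum>h\<in>F. of_bool (h \<in> stab x))"
    using assms by (intro sum.cong) (auto simp: fixed_def point_stabilizer_def indicator_def)
  thus ?thesis using assms(1) by (simp add: Int_def)
qed

text \<open>Double counting of the pairs \<open>(h, x)\<close> with \<open>h\<close> in
  \<open>F n\<close> and \<open>h \<otimes> g \<otimes> inv h\<close> fixing \<open>x\<close>.
  Integrated over \<open>x\<close>, their number is exactly
  \<open>card (F n) * prob (fixed {g})\<close>; for each \<open>x\<close> it is at most
  \<open>m * card (F n \<inter> stab x)\<close>.\<close>

lemma prob_fixed_locally_finite:
  assumes F: "\<And>n. subgroup (F n) G" "\<And>n. finite (F n)" "incseq F"
    and H: "subgroup (\<Union>n. F n) G" "infinite (\<Union>n. F n)" and g: "g \<in> (\<Union>n. F n)"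
  shows "prob (fixed {g}) = 0 \<or> prob (fixed {g}) = 1"
proof (rule ccontr)
  assume c: "\<not> (prob (fixed {g}) = 0 \<or> prob (fixed {g}) = 1)"
  interpret H: subgroup "\<Union>n. F n" G by (rule H)
  have gG: "g \<in> carrier G" using H.mem_carrier[OF g] .
  \<comment> \<open>The centralizer of \<open>g\<close> in the union; if it were infinite,
    \<open>prob_fixed_centralised\<close> would contradict the assumption on
    \<open>g\<close>.\<close>
  define C where "C = {h \<in> (\<Union>n. F n). h \<otimes> g = g \<otimes> h}"
  have "subgroup C G"
  proof (rule subgroupI)
    show "C \<subseteq> carrier G" using H.subset unfolding C_def by blast
    show "C \<noteq> {}" using g unfolding C_def by blast
    show "inv h \<in> C" if "h \<in> C" for h
    proof -
      have h: "h \<in> (\<Union>n. F n)" "h \<in> carrier G" "h \<otimes> g = g \<otimes> h"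
        using that H.mem_carrier unfolding C_def by auto
      have "inv h \<otimes> g = inv h \<otimes> (g \<otimes> h) \<otimes> inv h" using h(2) gG by (simp add: m_assoc)
      also have "\<dots> = inv h \<otimes> (h \<otimes> g) \<otimes> inv h" by (simp only: h(3))
      also have "\<dots> = g \<otimes> inv h" using h(2) gG by (simp add: m_assoc[symmetric])
      finally show ?thesis using H.m_inv_closed[OF h(1)] unfolding C_def by blast
    qed
    show "h \<otimes> k \<in> C" if "h \<in> C" "k \<in> C" for h k
    proof -
      have h: "h \<in> (\<Union>n. F n)" "h \<in> carrier G" "h \<otimes> g = g \<otimes> h"
        using that H.mem_carrier unfolding C_def by auto
      have k: "k \<in> (\<Union>n. F n)" "k \<in> carrier G" "k \<otimes> g = g \<otimes> k"
        using that H.mem_carrier unfolding C_def by auto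
      have "h \<otimes> k \<otimes> g = h \<otimes> (k \<otimes> g)" using h(2) k(2) gG by (rule m_assoc)
      also have "\<dots> = h \<otimes> g \<otimes> k" unfolding k(3) using h(2) gG k(2) by (rule m_assoc[symmetric])
      also have "\<dots> = g \<otimes> (h \<otimes> k)" unfolding h(3) using gG h(2) k(2) by (rule m_assoc)
      finally show ?thesis using H.m_closed[OF h(1) k(1)] unfolding C_def by blast
    qed
  qed
  hence "finite C" using prob_fixed_centralised[of C g] gG c unfolding C_def by blast
  define m where "m = card C"
  have "finite (insert g C)" "insert g C \<subseteq> (\<Union>n. F n)"
    using \<open>finite C\<close> g unfolding C_def by auto
  then obtain N where N: "\<And>n. n \<ge> N \<Longrightarrow> insert g C \<subseteq> F n"
    using finite_subset_incseq[OF _ _ F(3)] by metis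
  \<comment> \<open>The density of \<open>stab x\<close> in \<open>F n\<close>, written with
    indicators to make measurability evident; \<open>r_eq\<close> recovers the count.\<close>
  define r where "r n x = (\<Sum>h\<in>F n. indicator (fixed {h}) x) / real (card (F n))" for n x
  have Fsub: "F n \<subseteq> carrier G" for n using subgroup.subset F(1) by blast
  have Fpos: "real (card (F n)) > 0" for n
    using F(2) subgroup.one_closed[OF F(1)[of n]] by (auto simp: card_gt_0_iff)
  have mem[measurable]: "h \<in> F n \<Longrightarrow> fixed {h} \<in> sets M" for h n using Fsub by (intro sets_fixed) auto
  have r_meas[measurable]: "r n \<in> borel_measurable M" for n
    unfolding r_def by measurable
  have r_eq: "r n x = real (card (F n \<inter> stab x)) / real (card (F n))" if "x \<in> space M" for n x
    unfolding r_def using card_Int_stab_eq_sum[OF F(2) Fsub that] by simp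
  have r_le: "norm (r n x) \<le> 1" if "x \<in> space M" for n x
  proof -
    have "real (card (F n \<inter> stab x)) \<le> real (card (F n))" using F(2) by (simp add: card_mono)
    thus ?thesis unfolding r_eq[OF that] using Fpos[of n] by simp
  qed
  have r_int: "integrable M (r n)" for n
    by (rule integrable_const_bound[of _ 1]) (use r_le in \<open>auto intro: AE_I2\<close>)
  have "(\<lambda>n. integral\<^sup>L M (r n)) \<longlonglongrightarrow> integral\<^sup>L M (\<lambda>_. 0)"
  proof (rule integral_dominated_convergence[where w = "\<lambda>_. 1"])
    show "AE x in M. (\<lambda>n. r n x) \<longlonglongrightarrow> 0"
      using AE_stab_density_tendsto_0[OF F H] AE_space by eventually_elim (simp add: r_eq)
  qed (use r_le in auto)
  hence "(\<lambda>n. real m * integral\<^sup>L M (r n)) \<longlonglongrightarrow> 0"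
    using tendsto_mult_right_zero by fastforce
  moreover have "prob (fixed {g}) \<le> real m * integral\<^sup>L M (r n)" if n: "n \<ge> N" for n
  proof -
    interpret Fn: subgroup "F n" G by (rule F)
    have gF: "g \<in> F n" using N[OF n] by blast
    have conj: "h \<otimes> g \<otimes> inv h \<in> F n" if "h \<in> F n" for h using that gF by simp
    \<comment> \<open>If \<open>h\<close> and \<open>k\<close> conjugate \<open>g\<close> to the
      same \<open>b\<close>, then \<open>inv k \<otimes> h\<close> centralizes \<open>g\<close>.
      Left translation by \<open>inv k\<close> thus injects the fibre into \<open>C\<close>.\<close>
    have fibre: "card {h \<in> A. h \<otimes> g \<otimes> inv h = b} \<le> m" if A: "A \<subseteq> F n" for A b
    proof (cases "{h \<in> A. h \<otimes> g \<otimes> inv h = b} = {}")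
      case True
      show ?thesis unfolding True by simp
    next
      case False
      then obtain k where k: "k \<in> F n" "k \<otimes> g \<otimes> inv k = b" using A by blast
      have kG: "k \<in> carrier G" using k by (simp add: Fn.mem_carrier)
      have "inv k \<otimes> h \<in> C" if h: "h \<in> F n" "h \<otimes> g \<otimes> inv h = b" for h
      proof -
        have hG: "h \<in> carrier G" using h by (simp add: Fn.mem_carrier)
        have "h \<otimes> g = b \<otimes> h" using h(2) hG gG by (auto simp: m_assoc)
        moreover have "inv k \<otimes> b = g \<otimes> inv k" using k(2) kG gG by (auto simp: m_assoc[symmetric])
        moreover have "b \<in> carrier G" using h(2) hG gG by auto
        ultimately have "inv k \<otimes> h \<otimes> g = g \<otimes> (inv k \<otimes> h)"
          using hG kG gG by (metis inv_closed m_assoc)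
        moreover have "inv k \<otimes> h \<in> F n" using h k by simp
        ultimately show ?thesis unfolding C_def by blast
      qed
      hence "(\<lambda>h. inv k \<otimes> h) ` {h \<in> A. h \<otimes> g \<otimes> inv h = b} \<subseteq> C" using A by auto
      moreover have "inj_on (\<lambda>h. inv k \<otimes> h) {h \<in> A. h \<otimes> g \<otimes> inv h = b}"
        using A kG by (intro inj_onI) (auto simp: Fn.mem_carrier subset_iff)
      ultimately show ?thesis unfolding m_def using \<open>finite C\<close> by (intro card_inj_on_le)
    qed
    \<comment> \<open>The left side counts the \<open>h\<close> whose conjugate of \<open>g\<close>
      fixes \<open>x\<close>. Conjugation maps them into \<open>F n \<inter> stab x\<close> with
      fibres of size at most \<open>m\<close>.\<close>
    have "(\<Sum>h\<in>F n. indicator (fixed {h \<otimes> g \<otimes> inv h}) x) \<le> real m * (real (card (F n)) * r n x)"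
      if x: "x \<in> space M" for x
    proof -
      define A where "A = {h \<in> F n. h \<otimes> g \<otimes> inv h \<in> stab x}"
      have "(\<Sum>h\<in>F n. indicator (fixed {h \<otimes> g \<otimes> inv h}) x :: real) = (\<Sum>h\<in>F n. of_bool (h \<in> A))"
        using x gG Fn.mem_carrier unfolding A_def
        by (intro sum.cong) (auto simp: fixed_def point_stabilizer_def indicator_def)
      also have "\<dots> = real (card A)" using F(2) by (simp add: A_def Int_def)
      also have "card A \<le> m * card (F n \<inter> stab x)"
      proof (rule card_le_mult_card_fibres)
        show "card {h \<in> A. h \<otimes> g \<otimes> inv h = b} \<le> m" for b
          by (rule fibre) (auto simp: A_def)
      qed (use F(2) conj in \<open>auto simp: A_def\<close>)
      also have "real (m * card (F n \<inter> stab x)) = real m * (real (card (F n)) * r n x)"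
        using Fpos[of n] by (simp add: r_eq[OF x])
      finally show ?thesis by simp
    qed
    moreover have mem': "fixed {h \<otimes> g \<otimes> inv h} \<in> sets M" if "h \<in> F n" for h
      using mem conj[OF that] .
    ultimately have "integral\<^sup>L M (\<lambda>x. \<Sum>h\<in>F n. indicator (fixed {h \<otimes> g \<otimes> inv h}) x)
        \<le> integral\<^sup>L M (\<lambda>x. real m * (real (card (F n)) * r n x))"
      using r_int by (intro integral_mono) (auto simp: emeasure_eq_measure)
    also have "integral\<^sup>L M (\<lambda>x. \<Sum>h\<in>F n. indicator (fixed {h \<otimes> g \<otimes> inv h}) x)
        = (\<Sum>h\<in>F n. prob (fixed {h \<otimes> g \<otimes> inv h}))"
      using mem' by (subst Bochner_Integration.integral_sum) (auto simp: emeasure_eq_measure)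
    also have "\<dots> = real (card (F n)) * prob (fixed {g})"
      using prob_fixed_conjugate[OF gG Fn.mem_carrier] by simp
    finally have "real (card (F n)) * prob (fixed {g}) \<le> real (card (F n)) * (real m * integral\<^sup>L M (r n))"
      by (simp add: mult.left_commute)
    thus ?thesis using Fpos[of n] by simp
  qed
  ultimately have "prob (fixed {g}) \<le> 0"
    by (intro LIMSEQ_le_const[of _ 0]) auto
  thus False using c measure_nonneg[of M "fixed {g}"] by linarith
qed

section \<open>Almost sure finiteness of stabilizers\<close>

text \<open>A typical \<open>x\<close> avoids the null sets among the countably many
  \<open>fixed S\<close> with \<open>S\<close> finite. If \<open>stab x\<close> were infinite, it
  would be locally finite, so by \<open>prob_fixed_locally_finite\<close> each of its elements would
  fix almost every point. Then \<open>fixed (stab x)\<close> would be conull, against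
  \<open>prob_fixed_infinite_subgroup\<close>.\<close>

lemma AE_finite_stab: "AE x in M. finite (stab x)"
proof -
  define E where "E = {S. finite S \<and> S \<subseteq> carrier G}"
  have cE: "countable E" unfolding E_def
    using countable_Collect_finite_subset[OF countable_carrier] by (simp add: conj_commute)
  have "AE x in M. \<forall>S\<in>E. prob (fixed S) = 0 \<longrightarrow> x \<notin> fixed S"
  proof (rule AE_ball_countable'[OF _ cE])
    fix S assume "S \<in> E"
    hence "fixed S \<in> sets M" unfolding E_def by (intro sets_fixed) auto
    hence "prob (fixed S) = 0 \<Longrightarrow> fixed S \<in> null_sets M" by (auto simp: null_sets_def emeasure_eq_measure)
    thus "AE x in M. prob (fixed S) = 0 \<longrightarrow> x \<notin> fixed S" using AE_not_in by (cases "prob (fixed S) = 0") auto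
  qed
  thus ?thesis using AE_space
  proof eventually_elim
    case (elim x)
    show ?case
    proof (rule ccontr)
      assume inf: "infinite (stab x)"
      have sub: "subgroup (stab x) G" using elim(2) by (rule subgroup_stab)
      have stab_sub: "stab x \<subseteq> carrier G" using subgroup.subset[OF sub] .
      have nonnull: "prob (fixed S) \<noteq> 0" if "finite S" "S \<subseteq> stab x" for S
      proof -
        have "x \<in> fixed S" using that elim(2) by (auto simp: fixed_def point_stabilizer_def)
        moreover have "S \<in> E" using that stab_sub unfolding E_def by blast
        ultimately show ?thesis using elim(1) by blast
      qed
      \<comment> \<open>The generated group has the same fixed points as \<open>S\<close>, a
        non-null set, so it cannot be infinite.\<close>
      have fg: "finite (generate G S)" if "finite S" "S \<subseteq> stab x" for S
      proof (rule ccontr)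
        assume "infinite (generate G S)"
        moreover have SG: "S \<subseteq> carrier G" using that stab_sub by blast
        ultimately have "prob (fixed (generate G S)) = 0"
          using prob_fixed_infinite_subgroup generate_is_subgroup by blast
        thus False using nonnull[OF that] fixed_generate[OF SG] by simp
      qed
      define e where "e = from_nat_into (stab x)"
      have e: "range e = stab x"
        unfolding e_def using inf countable_subset_carrier[OF stab_sub]
        by (intro range_from_nat_into) auto
      \<comment> \<open>Generated by the first \<open>n + 1\<close> terms of an enumeration of
        \<open>stab x\<close>, so these finite groups increase to \<open>stab x\<close>.\<close>
      define F where "F n = generate G (e ` {..n})" for n
      have eG: "e ` {..n} \<subseteq> carrier G" for n using e stab_sub by blast
      have F: "subgroup (F n) G" "finite (F n)" "incseq F" for n
      proof -
        show "subgroup (F n) G" unfolding F_def by (rule generate_is_subgroup[OF eG])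
        show "finite (F n)" unfolding F_def using e by (intro fg) auto
        show "incseq F" unfolding F_def by (intro monoI mono_generate) auto
      qed
      have UF: "(\<Union>n. F n) = stab x"
      proof
        have "F n \<subseteq> stab x" for n
          unfolding F_def using e by (intro generate_subgroup_incl sub) auto
        thus "(\<Union>n. F n) \<subseteq> stab x" by blast
        have "e n \<in> F n" for n unfolding F_def by (intro generate.incl) auto
        thus "stab x \<subseteq> (\<Union>n. F n)" unfolding e[symmetric] by blast
      qed
      have "prob (fixed {g}) = 1" if "g \<in> stab x" for g
        using prob_fixed_locally_finite[of F g] F sub inf that nonnull[of "{g}"] unfolding UF by simp
      hence "AE y in M. y \<in> fixed {g}" if "g \<in> stab x" for g using that AE_prob_1 by blast
      hence "AE y in M. \<forall>g\<in>stab x. y \<in> fixed {g}"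
        by (intro AE_ball_countable' countable_subset_carrier stab_sub)
      hence "AE y in M. y \<in> fixed (stab x)"
        using AE_space by eventually_elim (auto simp: fixed_def)
      hence "prob (fixed (stab x)) = 1" using AE_in_set_eq_1 sets_fixed[OF stab_sub] by blast
      thus False using prob_fixed_infinite_subgroup[OF sub inf] by simp
    qed
  qed
qed

section \<open>The common stabilizer and its normality\<close>

lemma sets_stab_eq:
  assumes "F \<subseteq> carrier G"
  shows "{x \<in> space M. stab x = F} \<in> sets M"
proof -
  have "{x \<in> space M. stab x = F} = fixed F - (\<Union>g\<in>carrier G - F. fixed {g})"
    using assms by (auto simp: fixed_def point_stabilizer_def)
  moreover have "(\<Union>g\<in>carrier G - F. fixed {g}) \<in> sets M"
    by (intro sets.countable_UN'' countable_subset_carrier sets_fixed) auto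
  ultimately show ?thesis using assms by auto
qed

lemma AE_stab_eq_normal:
  "\<exists>N. N \<lhd> G \<and> finite N \<and> (AE x in M. stab x = N)"
proof -
  define A where "A F = {x \<in> space M. stab x = F}" for F
  have sA: "A F \<in> sets M" if "F \<subseteq> carrier G" for F
    unfolding A_def by (rule sets_stab_eq[OF that])
  \<comment> \<open>If every \<open>A F\<close> with \<open>F\<close> finite were null, so would be
    their countable union, against \<open>AE_finite_stab\<close>.\<close>
  have "\<exists>F. finite F \<and> F \<subseteq> carrier G \<and> prob (A F) \<noteq> 0"
  proof (rule ccontr)
    assume no: "\<not> ?thesis"
    have "AE x in M. \<forall>F\<in>{F. finite F \<and> F \<subseteq> carrier G}. x \<notin> A F"
    proof (rule AE_ball_countable'[OF _ countable_Collect_finite_subset[OF countable_carrier]])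
      fix F assume F: "F \<in> {F. finite F \<and> F \<subseteq> carrier G}"
      hence "A F \<in> null_sets M" using no sA[of F] by (auto simp: null_sets_def emeasure_eq_measure)
      thus "AE x in M. x \<notin> A F" by (rule AE_not_in)
    qed
    with AE_finite_stab AE_space have "AE x in M. False"
      by eventually_elim (auto simp: A_def point_stabilizer_def)
    thus False by simp
  qed
  then obtain F where F: "finite F" "F \<subseteq> carrier G" "prob (A F) \<noteq> 0" by blast
  have vim: "a h -` A F \<inter> space M \<in> sets M" "prob (a h -` A F \<inter> space M) = prob (A F)"
    if "h \<in> carrier G" for h
    using sets_vimage[OF that sA[OF F(2)]] prob_vimage[OF that sA[OF F(2)]] by auto
  have conj: "stab x = (\<lambda>g. inv h \<otimes> g \<otimes> h) ` F"
    if h: "h \<in> carrier G" and x: "x \<in> a h -` A F \<inter> space M" for h x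
  proof -
    have xs: "x \<in> space M" and stab: "stab (a h x) = F" using x by (auto simp: A_def)
    show ?thesis
    proof
      show "(\<lambda>g. inv h \<otimes> g \<otimes> h) ` F \<subseteq> stab x"
        using stab_act[OF h _ xs] F(2) unfolding stab by blast
      show "stab x \<subseteq> (\<lambda>g. inv h \<otimes> g \<otimes> h) ` F"
      proof
        fix s assume s: "s \<in> stab x"
        have sG: "s \<in> carrier G" using s by (simp add: point_stabilizer_def)
        have eq: "inv h \<otimes> (h \<otimes> s \<otimes> inv h) \<otimes> h = s"
          using h sG by (simp add: m_assoc) (simp add: m_assoc[symmetric])
        hence "h \<otimes> s \<otimes> inv h \<in> F" using stab_act[OF h _ xs, of "h \<otimes> s \<otimes> inv h"] s h sG stab by simp
        thus "s \<in> (\<lambda>g. inv h \<otimes> g \<otimes> h) ` F" using eq by (intro image_eqI) auto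
      qed
    qed
  qed
  \<comment> \<open>Translates of \<open>A F\<close> are again events of the form
    \<open>A F'\<close>, with \<open>F'\<close> a conjugate of \<open>F\<close>. As
    \<open>stab x\<close> has only one value, two translates coincide or are disjoint.\<close>
  have eq_A: "a h -` A F \<inter> space M = A ((\<lambda>g. inv h \<otimes> g \<otimes> h) ` F)" if h: "h \<in> carrier G" for h
  proof
    show "a h -` A F \<inter> space M \<subseteq> A ((\<lambda>g. inv h \<otimes> g \<otimes> h) ` F)"
      using conj[OF h] unfolding A_def by blast
    show "A ((\<lambda>g. inv h \<otimes> g \<otimes> h) ` F) \<subseteq> a h -` A F \<inter> space M"
    proof
      fix x assume "x \<in> A ((\<lambda>g. inv h \<otimes> g \<otimes> h) ` F)"
      hence x: "x \<in> space M" "stab x = (\<lambda>g. inv h \<otimes> g \<otimes> h) ` F" unfolding A_def by auto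
      have "g \<in> stab (a h x) \<longleftrightarrow> g \<in> F" if g: "g \<in> carrier G" for g
      proof -
        have "inv h \<otimes> g \<otimes> h = inv h \<otimes> g' \<otimes> h \<longleftrightarrow> g = g'" if "g' \<in> F" for g'
          using g h that F(2) by (auto simp: subset_iff)
        thus ?thesis unfolding stab_act[OF h g x(1)] x(2) by auto
      qed
      hence "stab (a h x) = F" using F(2) by (auto simp: point_stabilizer_def)
      thus "x \<in> a h -` A F \<inter> space M" using x h unfolding A_def by auto
    qed
  qed
  \<comment> \<open>The setwise stabilizer of \<open>A F\<close>. It is infinite because
    \<open>A F\<close> has only finitely many translates, which are disjoint and of equal positive
    measure.\<close>
  define S where "S = {h \<in> carrier G. a h -` A F \<inter> space M = A F}"
  have comp: "a (h \<otimes> k) -` B \<inter> space M = a k -` (a h -` B \<inter> space M) \<inter> space M"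
    if "h \<in> carrier G" "k \<in> carrier G" for h k B
    using that by (auto simp: act_mult)
  have shift: "k \<otimes> inv h \<in> S"
    if hk: "h \<in> carrier G" "k \<in> carrier G" "a h -` A F \<inter> space M = a k -` A F \<inter> space M" for h k
  proof -
    have "a (k \<otimes> inv h) -` A F \<inter> space M = a (h \<otimes> inv h) -` A F \<inter> space M"
      using hk by (subst (1 2) comp) auto
    also have "\<dots> = A F" using hk(1) by (auto simp: A_def)
    finally show ?thesis using hk unfolding S_def by simp
  qed
  have one: "a \<one> -` A F \<inter> space M = A F" by (auto simp: A_def)
  have subS: "subgroup S G"
  proof (rule subgroupI)
    show "S \<subseteq> carrier G" "S \<noteq> {}" using one unfolding S_def by auto
    show "inv h \<in> S" if "h \<in> S" for h
      using shift[of h \<one>] that one unfolding S_def by auto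
    show "h \<otimes> k \<in> S" if "h \<in> S" "k \<in> S" for h k
    proof -
      have h: "h \<in> carrier G" "a h -` A F \<inter> space M = A F"
        and k: "k \<in> carrier G" "a k -` A F \<inter> space M = A F" using that unfolding S_def by auto
      hence "a (h \<otimes> k) -` A F \<inter> space M = A F" by (simp only: comp)
      thus ?thesis using h k unfolding S_def by simp
    qed
  qed
  have "finite ((\<lambda>h. a h -` A F \<inter> space M) ` carrier G)"
  proof (rule finite_disjoint_equal_measure[where A = "\<lambda>B. B" and p = "prob (A F)"])
    show "disjoint_family_on (\<lambda>B. B) ((\<lambda>h. a h -` A F \<inter> space M) ` carrier G)"
      using eq_A by (auto simp: disjoint_family_on_def A_def)
  qed (use vim F(3) in \<open>auto simp: zero_less_measure_iff\<close>)
  hence "infinite S"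
    using infinite_subgroup_of_finite_image[OF subgroup_self infinite_carrier] shift by blast
  moreover have "a h -` A F \<inter> space M = A F" if "h \<in> S" for h using that by (simp add: S_def)
  ultimately have pA: "prob (A F) = 1"
    using ergodic_invariant[OF subS _ sA[OF F(2)]] F(3) by meson
  hence AE: "AE x in M. x \<in> A F" by (rule AE_prob_1)
  \<comment> \<open>\<open>A F\<close> and its preimage under \<open>a h\<close> are both conull, so
    they share a point \<open>x\<close>; its stabilizer is \<open>F\<close> and also the conjugate
    of \<open>F\<close>.\<close>
  have conjF: "(\<lambda>g. inv h \<otimes> g \<otimes> h) ` F = F" if h: "h \<in> carrier G" for h
  proof -
    have "AE x in M. x \<in> a h -` A F \<inter> space M" using vim(2)[OF h] pA by (intro AE_prob_1) simp
    with AE have both: "AE x in M. x \<in> A F \<and> x \<in> a h -` A F \<inter> space M" by eventually_elim auto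
    have "\<exists>x. x \<in> A F \<and> x \<in> a h -` A F \<inter> space M"
    proof (rule ccontr)
      assume no: "\<not> ?thesis"
      from both have "AE x in M. False" by (rule eventually_mono) (use no in blast)
      thus False by simp
    qed
    then obtain x where x: "x \<in> A F" "x \<in> a h -` A F \<inter> space M" by blast
    have "stab x = F" using x(1) unfolding A_def by blast
    thus ?thesis by (rule trans[OF sym[OF conj[OF h x(2)]]])
  qed
  have "A F \<noteq> {}" using F(3) by auto
  then obtain x where "x \<in> A F" by blast
  hence "subgroup F G" using subgroup_stab unfolding A_def by auto
  moreover have "h \<otimes> g \<otimes> inv h \<in> F" if "h \<in> carrier G" "g \<in> F" for h g
  proof -
    have "inv (inv h) \<otimes> g \<otimes> inv h \<in> F"
      using imageI[OF that(2)] by (subst conjF[OF inv_closed[OF that(1)], symmetric])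
    thus ?thesis using that(1) by simp
  qed
  ultimately have "F \<lhd> G" by (intro normal_invI)
  moreover have "AE x in M. stab x = F" using AE by (auto simp: A_def elim: eventually_mono)
  ultimately show ?thesis using F(1) by blast
qed

end

theorem theorem1p4:
  fixes G :: "('g, 'b) monoid_scheme" and M :: "'x measure" and a :: "'g \<Rightarrow> 'x \<Rightarrow> 'x"
  assumes "countable (carrier G)" and "infinite (carrier G)"
    and "mp_action G M a"
    and "\<not> point_mass M"
    and "totally_ergodic G M a"
  shows "\<exists>N. N \<lhd> G \<and> finite N \<and> (AE x in M. point_stabilizer G a x = N)"
proof -
  have "group G" "prob_space M" using assms(3) by (auto simp: mp_action_def)
  then interpret totally_ergodic_action G M a
    using assms by (intro totally_ergodic_action.intro pmp_action.intro pmp_action_axioms.intro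
      totally_ergodic_action_axioms.intro) (auto simp: mp_action_def)
  show ?thesis by (rule AE_stab_eq_normal)
qed

end
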